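(* There exist infinitely many triples $(x,y,z)$ of nonzero elements of the Fibonacci model set $\Lambda$ such that $x^3+y^3=z^3$.
   Context: $\tau=\frac{1+\sqrt5}{2}$, $\tau'=\frac{1-\sqrt5}{2}$, and $\mathbb{Z}[\tau]=\{m+n\tau \mid m,n\in\mathbb{Z}\}$. The Galois conjugation $\sigma:\mathbb{Z}[\tau]\to\mathbb{Z}[\tau]$ is $\sigma(m+n\tau)=m+n\tau'$ for $m,n\in\mathbb{Z}$. The Fibonacci model set is $\Lambda=\{x\in\mathbb{Z}[\tau] \mid \sigma(x)\in[-1,\tau-1)\}$, the half-open interval being taken in $\mathbb{R}$. *)

theory Defs
  imports Complex_Main "HOL-Computational_Algebra.Primes"
begin

definition tau :: real where
  "tau = (1 + sqrt 5) / 2"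

definition tau' :: real where
  "tau' = (1 - sqrt 5) / 2"

definition Z_tau :: "real set" where
  "Z_tau = {of_int m + of_int n * tau | m n :: int. True}"

text \<open>The Galois conjugation is a map on \<open>Z_tau\<close>, rendered as a function on the reals that is
  meaningful on \<open>Z_tau\<close> only. The description is well defined there because the representation
  \<open>m + n * tau\<close> is unique, see \<open>galois_conj_eq\<close> below.\<close>

definition galois_conj :: "real \<Rightarrow> real" where
  "galois_conj x =
     (THE y. \<exists>m n :: int. x = of_int m + of_int n * tau \<and> y = of_int m + of_int n * tau')"

definition Fibonacci_model_set :: "real set" where
  "Fibonacci_model_set = {x \<in> Z_tau. galois_conj x \<in> {-1 ..< tau - 1}}"

lemma square_eq_5_square_int:
  fixes a b :: int
  assumes "a\<^sup>2 = 5 * b\<^sup>2"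
  shows "b = 0"
proof (rule ccontr)
  assume b: "b \<noteq> 0"
  with assms have a: "a \<noteq> 0" by auto
  have p: "prime (5::int)" by simp
  have "2 * multiplicity 5 a = multiplicity 5 (a\<^sup>2)"
    using a p by (simp add: prime_elem_multiplicity_power_distrib)
  also have "\<dots> = Suc (2 * multiplicity 5 b)"
    using b p by (simp add: assms prime_elem_multiplicity_mult_distrib
        prime_elem_multiplicity_power_distrib)
  finally show False by presburger
qed

lemma Z_tau_repr_unique:
  fixes m n k l :: int
  assumes "of_int m + of_int n * tau = of_int k + of_int l * tau"
  shows "m = k" "n = l"
proof -
  define c d where "c = 2 * (m - k) + (n - l)" and "d = n - l"
  have "real_of_int c = - real_of_int d * sqrt 5"
    using assms by (simp add: c_def d_def tau_def field_simps)
  then have "(real_of_int c)\<^sup>2 = 5 * (real_of_int d)\<^sup>2"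
    by (simp add: power_mult_distrib)
  then have "real_of_int (c\<^sup>2) = real_of_int (5 * d\<^sup>2)" by simp
  then have "c\<^sup>2 = 5 * d\<^sup>2" by (simp only: of_int_eq_iff)
  then show "n = l" using square_eq_5_square_int d_def by fastforce
  with assms show "m = k" by simp
qed

lemma galois_conj_eq:
  "galois_conj (of_int m + of_int n * tau) = of_int m + of_int n * tau'"
  unfolding galois_conj_def
  by (rule the_equality) (auto dest: Z_tau_repr_unique)

end

theory Submission
  imports Defs
begin

text \<open>From \<open>(9 + sqrt 5)\<^sup>3 + (9 - sqrt 5)\<^sup>3 = 12\<^sup>3\<close> one gets, after halving,
  \<open>(4 + \<tau>)\<^sup>3 + (5 - \<tau>)\<^sup>3 = 6\<^sup>3\<close>. The equation is homogeneous, so it may be multiplied by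
  powers of the unit \<open>\<tau>\<close>. Their conjugates \<open>\<tau>'\<^sup>k\<close> tend to \<open>0\<close> and bring the conjugates of all
  three entries into the window for \<open>k \<ge> 5\<close>.\<close>

lemma tau_squared: "tau\<^sup>2 = tau + 1" and tau'_squared: "tau'\<^sup>2 = tau' + 1"
  by (simp_all add: tau_def tau'_def power2_eq_square field_simps)

lemma sqrt_5_bounds: "2.236 < sqrt 5" "sqrt 5 < 2.237"
  by (rule real_less_rsqrt, simp add: power2_eq_square)
    (rule real_less_lsqrt, simp_all add: power2_eq_square)

lemma tau_bounds: "1.618 < tau" "tau < 1.6185"
  using sqrt_5_bounds by (auto simp: tau_def)

lemma tau'_bounds: "- 0.6185 < tau'" "tau' < - 0.618"
  using sqrt_5_bounds by (auto simp: tau'_def)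

text \<open>Both equations share the coefficients \<open>m\<close> and \<open>n\<close>, so
  \<open>galois_conj_eq\<close> reads off the conjugate of the product without any appeal to
  multiplicativity of \<open>galois_conj\<close>.\<close>

lemma Z_tau_mult_tau_power:
  fixes p q :: int
  shows "\<exists>m n :: int. (of_int p + of_int q * tau) * tau ^ k = of_int m + of_int n * tau \<and>
    (of_int p + of_int q * tau') * tau' ^ k = of_int m + of_int n * tau'"
proof (induction k)
  case 0
  show ?case by auto
next
  case (Suc k)
  then obtain m n :: int where
    IH: "(of_int p + of_int q * tau) * tau ^ k = of_int m + of_int n * tau"
      "(of_int p + of_int q * tau') * tau' ^ k = of_int m + of_int n * tau'"
    by blast
  \<comment> \<open>Stated for any root \<open>t\<close> of \<open>t\<^sup>2 = t + 1\<close>, so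
    that \<open>tau\<close> and \<open>tau'\<close> undergo the same update of coefficients,
    \<open>(m, n)\<close> to \<open>(n, m + n)\<close>.\<close>
  have step: "(of_int p + of_int q * t) * t ^ Suc k = of_int n + of_int (m + n) * t"
    if "t\<^sup>2 = t + 1" "(of_int p + of_int q * t) * t ^ k = of_int m + of_int n * t" for t :: real
  proof -
    have "(of_int p + of_int q * t) * t ^ Suc k = (of_int m + of_int n * t) * t"
      by (simp flip: that(2))
    also have "\<dots> = of_int m * t + of_int n * t\<^sup>2"
      by (simp add: power2_eq_square algebra_simps)
    finally show ?thesis
      by (simp add: that(1) algebra_simps)
  qed
  show ?case
    using step[OF tau_squared IH(1)] step[OF tau'_squared IH(2)] by blast
qed

text \<open>The quadratic relation makes \<open>tau' ^ 5\<close> linear in \<open>tau'\<close>, and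
  0.0925 is \<open>\<bar>5 * tau' + 3\<bar>\<close> at the lower bound \<open>- 0.6185\<close>.
  Higher powers are smaller since \<open>\<bar>tau'\<bar> < 1\<close>.\<close>

lemma abs_tau'_power_le:
  assumes "5 \<le> k"
  shows "\<bar>tau'\<bar> ^ k \<le> 0.0925"
proof -
  have "tau' ^ 5 = tau' * (tau'\<^sup>2)\<^sup>2"
    by (simp add: eval_nat_numeral)
  also have "\<dots> = 5 * tau' + 3"
    using tau'_squared by (simp add: power2_eq_square algebra_simps)
  finally have "\<bar>tau'\<bar> ^ 5 \<le> 0.0925"
    using tau'_bounds by (simp flip: power_abs)
  moreover have "\<bar>tau'\<bar> ^ k \<le> \<bar>tau'\<bar> ^ 5"
    using tau'_bounds assms by (intro power_decreasing) auto
  ultimately show ?thesis by linarith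
qed

lemma mult_tau_power_in_Fibonacci_model_set:
  fixes p q :: int
  assumes bound: "\<bar>of_int p + of_int q * tau'\<bar> \<le> 6" and k: "5 \<le> k"
  shows "(of_int p + of_int q * tau) * tau ^ k \<in> Fibonacci_model_set"
proof -
  obtain m n :: int where
    mn: "(of_int p + of_int q * tau) * tau ^ k = of_int m + of_int n * tau"
      "(of_int p + of_int q * tau') * tau' ^ k = of_int m + of_int n * tau'"
    using Z_tau_mult_tau_power by blast
  have "\<bar>of_int m + of_int n * tau'\<bar> = \<bar>of_int p + of_int q * tau'\<bar> * \<bar>tau'\<bar> ^ k"
    by (simp add: abs_mult power_abs flip: mn(2))
  also have "\<dots> \<le> 6 * 0.0925"
    using bound abs_tau'_power_le[OF k] by (intro mult_mono) auto
  finally have "\<bar>of_int m + of_int n * tau'\<bar> \<le> 6 * 0.0925" .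
  \<comment> \<open>The right end of the window is the critical one: 6 * 0.0925 = 0.555 < 0.618 <
    \<open>tau - 1\<close>.\<close>
  from abs_le_D1[OF this] abs_le_D2[OF this]
  have "of_int m + of_int n * tau' \<in> {-1 ..< tau - 1}"
    using tau_bounds by simp
  then show ?thesis
    by (auto simp: Fibonacci_model_set_def mn(1) galois_conj_eq Z_tau_def)
qed

theorem proposition4p11:
  shows "infinite {(x, y, z).
           x \<in> Fibonacci_model_set - {0} \<and>
           y \<in> Fibonacci_model_set - {0} \<and>
           z \<in> Fibonacci_model_set - {0} \<and>
           x ^ 3 + y ^ 3 = z ^ 3}"
    (is "infinite ?S")
proof -
  define f where "f j = ((4 + tau) * tau ^ (j + 5), (5 - tau) * tau ^ (j + 5), 6 * tau ^ (j + 5))"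
    for j :: nat
  have "f j \<in> ?S" for j
  proof -
    \<comment> \<open>The conjugates of the three factors are about 3.38, 5.62 and exactly 6, which
      explains the bound 6.\<close>
    have "(4 + tau) * tau ^ (j + 5) \<in> Fibonacci_model_set"
      using mult_tau_power_in_Fibonacci_model_set[of 4 1 "j + 5"] tau'_bounds by simp
    moreover have "(5 - tau) * tau ^ (j + 5) \<in> Fibonacci_model_set"
      using mult_tau_power_in_Fibonacci_model_set[of 5 "-1" "j + 5"] tau'_bounds by simp
    moreover have "6 * tau ^ (j + 5) \<in> Fibonacci_model_set"
      using mult_tau_power_in_Fibonacci_model_set[of 6 0 "j + 5"] by simp
    moreover have "(4 + tau) ^ 3 + (5 - tau) ^ 3 = 6 ^ 3"
    proof -
      \<comment> \<open>The cubic terms cancel, and \<open>tau\<^sup>2 - tau = 1\<close> leaves 189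
        + 27 = 216.\<close>
      have "(4 + tau) ^ 3 + (5 - tau) ^ 3 = 189 + 27 * (tau\<^sup>2 - tau)"
        by (simp add: power2_eq_square power3_eq_cube algebra_simps)
      then show ?thesis by (simp add: tau_squared)
    qed
    then have "((4 + tau) * tau ^ (j + 5)) ^ 3 + ((5 - tau) * tau ^ (j + 5)) ^ 3
        = (6 * tau ^ (j + 5)) ^ 3"
      by (simp only: power_mult_distrib flip: distrib_right)
    \<comment> \<open>The bounds on \<open>tau\<close> make \<open>4 + tau\<close>,
      \<open>5 - tau\<close> and \<open>tau\<close> nonzero.\<close>
    ultimately show ?thesis
      using tau_bounds by (simp add: f_def)
  qed
  then have "range f \<subseteq> ?S" by (rule image_subsetI)
  \<comment> \<open>Since \<open>tau > 1\<close>, distinct exponents give distinct powers.\<close>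
  moreover have "inj f"
    using tau_bounds by (auto simp: f_def inj_def)
  then have "infinite (range f)"
    by (simp add: finite_image_iff)
  ultimately show ?thesis
    using infinite_super by blast
qed

end
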